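(* Let $\mathcal{M}$ and $\mathcal{N}$ be projective qubit measurements determined by vector states $|\varphi\rangle$ and $|\psi\rangle$ of $\mathcal{H}_2$, respectively, i.e. $M_1=|\varphi\rangle\langle\varphi|$, $M_2=|\varphi^\perp\rangle\langle\varphi^\perp|$ and $N_1=|\psi\rangle\langle\psi|$, $N_2=|\psi^\perp\rangle\langle\psi^\perp|$, where $\{|\varphi\rangle,|\varphi^\perp\rangle\}$ and $\{|\psi\rangle,|\psi^\perp\rangle\}$ are orthonormal bases of $\mathcal{H}_2$. The problem of optimal discrimination with fixed failure rate $p_f$ of the measurements $\mathcal{M}$ and $\mathcal{N}$ is mathematically equivalent to the problem of optimal discrimination with fixed failure rate $p_f$ of the pure states $|\varphi\rangle$, $|\psi\rangle$.
   Context: $\mathcal{H}_2$ is the two-dimensional complex Hilbert space. The prior probabilities are $\eta_{\mathcal M},\eta_{\mathcal N}\ge0$, $\eta_{\mathcal M}+\eta_{\mathcal N}=1$, assigned to $\mathcal{M}$ and $\mathcal{N}$ in the measurement problem and to $|\varphi\rangle$ and $|\psi\rangle$, respectively, in the state problem. Discrimination of measurements (single use, general ancilla-assisted): a test $\mathcal{T}$ with conclusions $c\in\{\mathcal{M},\mathcal{N},f\}$ ($f$ = inconclusive) is a family of positive semidefinite operators $H^{(c)}_j$ on $\mathcal{H}_2$, $j=1,2$, with $\sum_c H^{(c)}_j=\rho$ for $j=1,2$, where $\rho\ge0$, $\mathrm{tr}[\rho]=1$, is independent of $j$. The probability of conclusion $c$ when the tested measurement $\mathcal{A}$ has POVM $\{A_1,A_2\}$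 is $p(c|\mathcal{A},\mathcal{T})=\sum_j \mathrm{tr}[H^{(c)}_jA_j]$. The success, error and failure probabilities are $p_s=\eta_{\mathcal M}p(\mathcal M|\mathcal M,\mathcal T)+\eta_{\mathcal N}p(\mathcal N|\mathcal N,\mathcal T)$, $p_e=\eta_{\mathcal M}p(\mathcal N|\mathcal M,\mathcal T)+\eta_{\mathcal N}p(\mathcal M|\mathcal N,\mathcal T)$, $p_f=\eta_{\mathcal M}p(f|\mathcal M,\mathcal T)+\eta_{\mathcal N}p(f|\mathcal N,\mathcal T)$. Discrimination of states: one uses a POVM $E_{\mathcal M},E_{\mathcal N},E_f\ge0$, $E_{\mathcal M}+E_{\mathcal N}+E_f=I$ on $\mathcal{H}_2$ (the outcome $\mathcal{M}$ standing for the conclusion $|\varphi\rangle$ and $\mathcal{N}$ for $|\psi\rangle$), with $p_s=\eta_{\mathcal M}\langle\varphi|E_{\mathcal M}|\varphi\rangle+\eta_{\mathcal N}\langle\psi|E_{\mathcal N}|\psi\rangle$, $p_e=\eta_{\mathcal M}\langle\varphi|E_{\mathcal N}|\varphi\rangle+\eta_{\mathcal N}\langle\psi|E_{\mathcal M}|\psi\rangle$, $p_f=\eta_{\mathcal M}\langle\varphi|E_f|\varphi\rangle+\eta_{\mathcal N}\langle\psi|E_f|\psi\rangle$. Optimal discrimination with fixed failure rate $p_f$ means maximizing $p_s$ over all tests (respectively POVMs) whose failure probability equals the given value $p_f$. *)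

theory Defs
  imports "HOL-Analysis.Analysis"
begin

(* Vectors of the two-dimensional complex Hilbert space are of type complex^2, operators of type
   complex^2^2.  The inner product of the class real_inner on complex^2 is only the real part of
   the Hermitian product, hence the definition below (antilinear in the first argument). *)

definition braket :: "complex^2 \<Rightarrow> complex^2 \<Rightarrow> complex" where
  "braket u v = (\<Sum>i\<in>UNIV. cnj (u $ i) * v $ i)"

definition psd :: "complex^2^2 \<Rightarrow> bool" where
  "psd A \<longleftrightarrow> (\<forall>v. braket v (A *v v) \<in> \<real> \<and> 0 \<le> Re (braket v (A *v v)))"

definition ketbra :: "complex^2 \<Rightarrow> complex^2^2" where
  "ketbra v = (\<chi> i k. v $ i * cnj (v $ k))"

(* In dimension two, orthonormality of the pair already makes it a basis. *)
definition orthonormal_basis :: "complex^2 \<Rightarrow> complex^2 \<Rightarrow> bool" where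
  "orthonormal_basis u v \<longleftrightarrow> braket u u = 1 \<and> braket v v = 1 \<and> braket u v = 0"

(* The outcomes j = 1, 2 are the two elements of the type 2 (where 2 = 0 and 1 \<noteq> 2). *)
definition projective_measurement :: "complex^2 \<Rightarrow> complex^2 \<Rightarrow> 2 \<Rightarrow> complex^2^2" where
  "projective_measurement u v j = (if j = 1 then ketbra u else ketbra v)"

(* ConcM stands for the measurement M, resp. the state phi; ConcN for N, resp. psi. *)
datatype conclusion = ConcM | ConcN | Inconclusive

definition success_prob ::
  "real \<Rightarrow> real \<Rightarrow> (conclusion \<Rightarrow> real) \<Rightarrow> (conclusion \<Rightarrow> real) \<Rightarrow> real" where
  "success_prob \<eta>M \<eta>N pM pN = \<eta>M * pM ConcM + \<eta>N * pN ConcN"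

definition error_prob ::
  "real \<Rightarrow> real \<Rightarrow> (conclusion \<Rightarrow> real) \<Rightarrow> (conclusion \<Rightarrow> real) \<Rightarrow> real" where
  "error_prob \<eta>M \<eta>N pM pN = \<eta>M * pM ConcN + \<eta>N * pN ConcM"

definition failure_prob ::
  "real \<Rightarrow> real \<Rightarrow> (conclusion \<Rightarrow> real) \<Rightarrow> (conclusion \<Rightarrow> real) \<Rightarrow> real" where
  "failure_prob \<eta>M \<eta>N pM pN = \<eta>M * pM Inconclusive + \<eta>N * pN Inconclusive"

definition measurement_test :: "(conclusion \<Rightarrow> 2 \<Rightarrow> complex^2^2) \<Rightarrow> bool" where
  "measurement_test H \<longleftrightarrow>
     (\<forall>c j. psd (H c j)) \<and>
     (\<exists>\<rho>. psd \<rho> \<and> trace \<rho> = 1 \<and> (\<forall>j. H ConcM j + H ConcN j + H Inconclusive j = \<rho>))"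

(* The traces are real whenever H is a test and A a POVM; Re only adjusts the type. *)
definition measurement_prob ::
  "(conclusion \<Rightarrow> 2 \<Rightarrow> complex^2^2) \<Rightarrow> (2 \<Rightarrow> complex^2^2) \<Rightarrow> conclusion \<Rightarrow> real" where
  "measurement_prob H A c = (\<Sum>j\<in>UNIV. Re (trace (H c j ** A j)))"

definition optimal_measurement_test ::
  "real \<Rightarrow> real \<Rightarrow> (2 \<Rightarrow> complex^2^2) \<Rightarrow> (2 \<Rightarrow> complex^2^2) \<Rightarrow> real \<Rightarrow>
     (conclusion \<Rightarrow> 2 \<Rightarrow> complex^2^2) \<Rightarrow> bool" where
  "optimal_measurement_test \<eta>M \<eta>N M N pf H \<longleftrightarrow>
     measurement_test H \<and>
     failure_prob \<eta>M \<eta>N (measurement_prob H M) (measurement_prob H N) = pf \<and>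
     (\<forall>H'. measurement_test H' \<and>
           failure_prob \<eta>M \<eta>N (measurement_prob H' M) (measurement_prob H' N) = pf \<longrightarrow>
        success_prob \<eta>M \<eta>N (measurement_prob H' M) (measurement_prob H' N)
          \<le> success_prob \<eta>M \<eta>N (measurement_prob H M) (measurement_prob H N))"

definition state_povm :: "(conclusion \<Rightarrow> complex^2^2) \<Rightarrow> bool" where
  "state_povm E \<longleftrightarrow> (\<forall>c. psd (E c)) \<and> E ConcM + E ConcN + E Inconclusive = mat 1"

definition state_prob :: "(conclusion \<Rightarrow> complex^2^2) \<Rightarrow> complex^2 \<Rightarrow> conclusion \<Rightarrow> real" where
  "state_prob E v c = Re (braket v (E c *v v))"

definition optimal_state_povm ::
  "real \<Rightarrow> real \<Rightarrow> complex^2 \<Rightarrow> complex^2 \<Rightarrow> real \<Rightarrow> (conclusion \<Rightarrow> complex^2^2) \<Rightarrow> bool" where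
  "optimal_state_povm \<eta>M \<eta>N \<phi> \<psi> pf E \<longleftrightarrow>
     state_povm E \<and>
     failure_prob \<eta>M \<eta>N (state_prob E \<phi>) (state_prob E \<psi>) = pf \<and>
     (\<forall>E'. state_povm E' \<and> failure_prob \<eta>M \<eta>N (state_prob E' \<phi>) (state_prob E' \<psi>) = pf \<longrightarrow>
        success_prob \<eta>M \<eta>N (state_prob E' \<phi>) (state_prob E' \<psi>)
          \<le> success_prob \<eta>M \<eta>N (state_prob E \<phi>) (state_prob E \<psi>))"

end

theory Submission imports Defs begin

text \<open>In dimension two the adjugate \<open>tr(A) I - A\<close> of \<open>A\<close> is conjugate to \<open>A\<close> by the antiunitary
spin flip, so it is positive semidefinite whenever \<open>A\<close> is; its expectation at a unit
vector \<open>\<phi>\<close> equals the expectation of \<open>A\<close> at \<open>\<phi>\<^sup>\<bottom>\<close>. Hence the second outcome of a projective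
measurement can be traded for the first one, and a test \<open>H\<close> has the same conclusion
probabilities as the POVM \<open>H\<^sub>1 + adj(H\<^sub>2)\<close>, whose elements sum to \<open>\<rho> + (tr \<rho>) I - \<rho> = I\<close>.
Conversely a POVM \<open>E\<close> is simulated by the test \<open>H\<^sub>1 = E/2\<close>, \<open>H\<^sub>2 = adj(E)/2\<close> with \<open>\<rho> = I/2\<close>.\<close>

definition adj2 :: "complex^2^2 \<Rightarrow> complex^2^2" where
  "adj2 A = mat (trace A) - A"

text \<open>Entrywise conjugation followed by -i sigma_y; it sends a vector to an orthogonal one of
  equal norm.\<close>

definition spin_flip :: "complex^2 \<Rightarrow> complex^2" where
  "spin_flip v = (\<chi> i. if i = 1 then - cnj (v $ 2) else cnj (v $ 1))"

lemma complex_matrix_2_eqI: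
  fixes A B :: "complex^2^2"
  assumes "A $ 1 $ 1 = B $ 1 $ 1" "A $ 1 $ 2 = B $ 1 $ 2" "A $ 2 $ 1 = B $ 2 $ 1" "A $ 2 $ 2 = B $ 2 $ 2"
  shows "A = B"
  using assms by (simp add: vec_eq_iff forall_2)

lemma trace_2: "trace (A :: complex^2^2) = A $ 1 $ 1 + A $ 2 $ 2"
  by (simp add: trace_def sum_2)

text \<open>\<open>adj2\<close> swaps the diagonal entries of \<open>A\<close> and negates the
  others, so both sides expand to the same polynomial in the entries of \<open>A\<close>,
  \<open>v\<close> and \<open>cnj v\<close>.\<close>

lemma braket_adj2: "braket v (adj2 A *v v) = braket (spin_flip v) (A *v spin_flip v)"
  by (simp add: braket_def adj2_def spin_flip_def matrix_vector_mult_def mat_def trace_2 sum_2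
      algebra_simps)

lemma psd_adj2: "psd A \<Longrightarrow> psd (adj2 A)"
  by (simp add: psd_def braket_adj2)

lemma psd_add:
  assumes "psd A" "psd B"
  shows "psd (A + B)"
proof -
  have "braket v ((A + B) *v v) = braket v (A *v v) + braket v (B *v v)" for v
    by (simp add: braket_def matrix_vector_mult_add_rdistrib sum.distrib distrib_left)
  then show ?thesis
    using assms by (simp add: psd_def)
qed

lemma psd_scaleR:
  assumes "psd A" "0 \<le> r"
  shows "psd (r *\<^sub>R A)"
proof -
  have "braket v ((r *\<^sub>R A) *v v) = r *\<^sub>R braket v (A *v v)" for v
    by (simp add: braket_def matrix_vector_mult_def sum_2 algebra_simps)
  then show ?thesis
    using assms by (simp add: psd_def scaleR_conv_of_real)
qed

lemma psd_mat_1: "psd (mat 1)"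
  by (simp add: psd_def braket_def sum_2 mult.commute complex_mult_cnj flip: of_real_add)

lemma trace_mult_ketbra: "trace (A ** ketbra v) = braket v (A *v v)"
  by (simp add: trace_def ketbra_def braket_def matrix_matrix_mult_def matrix_vector_mult_def sum_2
      algebra_simps)

lemma orthonormal_basis_completeness:
  assumes "orthonormal_basis u v"
  shows "ketbra u + ketbra v = mat 1"
proof -
  \<comment> \<open>\<open>U\<close> has columns \<open>u\<close> and \<open>v\<close>, and
    \<open>V\<close> is its conjugate transpose: \<open>V ** U = mat 1\<close> is orthonormality,
    \<open>U ** V = mat 1\<close> is completeness, and for square matrices the one gives the
    other.\<close>
  define U :: "complex^2^2" where "U = (\<chi> i k. if k = 1 then u $ i else v $ i)"
  define V :: "complex^2^2" where "V = (\<chi> i k. cnj (U $ k $ i))"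
  have "cnj (braket u v) = braket v u"
    by (simp add: braket_def mult.commute)
  then have "braket v u = 0"
    using assms by (simp add: orthonormal_basis_def)
  then have "V ** U = mat 1"
    using assms
    by (intro complex_matrix_2_eqI)
      (simp_all add: U_def V_def orthonormal_basis_def braket_def matrix_matrix_mult_def mat_def sum_2)
  then have "U ** V = mat 1"
    by (simp add: matrix_left_right_inverse)
  moreover have "U ** V = ketbra u + ketbra v"
    by (intro complex_matrix_2_eqI)
      (simp_all add: U_def V_def ketbra_def matrix_matrix_mult_def sum_2)
  ultimately show ?thesis
    by simp
qed

text \<open>By completeness the expectations of \<open>A\<close> at \<open>u\<close> and
  \<open>v\<close> add up to its trace, so subtracting the one at \<open>u\<close> from the trace
  leaves the one at \<open>v\<close>. This avoids identifying \<open>v\<close> with the spin flip of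
  \<open>u\<close> up to a phase.\<close>

lemma braket_adj2_orthonormal:
  assumes "orthonormal_basis u v"
  shows "braket u (adj2 A *v u) = braket v (A *v v)"
proof -
  have "braket u (A *v u) + braket v (A *v v) = trace (A ** (ketbra u + ketbra v))"
    by (simp add: matrix_add_ldistrib trace_add trace_mult_ketbra)
  also have "\<dots> = trace A"
    by (simp add: orthonormal_basis_completeness[OF assms])
  finally have *: "braket u (A *v u) + braket v (A *v v) = trace A" .
  have "braket u (adj2 A *v u) = trace A * braket u u - braket u (A *v u)"
    by (simp add: braket_def adj2_def matrix_vector_mult_def mat_def sum_2 algebra_simps)
  also have "\<dots> = trace A - braket u (A *v u)"
    using assms by (simp add: orthonormal_basis_def)
  also have "\<dots> = braket v (A *v v)"
    unfolding *[symmetric] by simp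
  finally show ?thesis .
qed

definition povm_of_test :: "(conclusion \<Rightarrow> 2 \<Rightarrow> complex^2^2) \<Rightarrow> conclusion \<Rightarrow> complex^2^2" where
  "povm_of_test H c = H c 1 + adj2 (H c 2)"

definition test_of_povm :: "(conclusion \<Rightarrow> complex^2^2) \<Rightarrow> conclusion \<Rightarrow> 2 \<Rightarrow> complex^2^2" where
  "test_of_povm E c j = (1/2) *\<^sub>R (if j = 1 then E c else adj2 (E c))"

lemma adj2_add: "adj2 (A + B) = adj2 A + adj2 B"
  by (intro complex_matrix_2_eqI) (simp_all add: adj2_def mat_def trace_2)

lemma adj2_scaleR: "adj2 (r *\<^sub>R A) = r *\<^sub>R adj2 A"
  by (intro complex_matrix_2_eqI) (simp_all add: adj2_def mat_def trace_2 algebra_simps)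

text \<open>In dimension two, tr(A) I - A again has trace 2 tr(A) - tr(A) = tr(A).\<close>

lemma adj2_adj2: "adj2 (adj2 A) = A"
  by (intro complex_matrix_2_eqI) (simp_all add: adj2_def mat_def trace_2)

lemma adj2_mat_1: "adj2 (mat 1) = mat 1"
  by (intro complex_matrix_2_eqI) (simp_all add: adj2_def mat_def trace_2)

lemma state_povm_povm_of_test:
  assumes "measurement_test H"
  shows "state_povm (povm_of_test H)"
proof -
  obtain \<rho> where \<rho>: "trace \<rho> = 1" "\<And>j. H ConcM j + H ConcN j + H Inconclusive j = \<rho>"
    using assms by (auto simp: measurement_test_def)
  have "povm_of_test H ConcM + povm_of_test H ConcN + povm_of_test H Inconclusive
      = (H ConcM 1 + H ConcN 1 + H Inconclusive 1) + adj2 (H ConcM 2 + H ConcN 2 + H Inconclusive 2)"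
    by (simp add: povm_of_test_def adj2_add algebra_simps)
  \<comment> \<open>Both sums are the same \<rho>, as it is independent of the outcome; it cancels,
    leaving tr(\<rho>) I with tr(\<rho>) = 1.\<close>
  also have "\<dots> = mat 1"
    unfolding \<rho>(2) by (simp add: adj2_def \<rho>(1))
  finally show ?thesis
    using assms by (simp add: state_povm_def measurement_test_def povm_of_test_def psd_add psd_adj2)
qed

text \<open>Each outcome contributes half of \<open>E c\<close>. The other composition is not the
  identity: it replaces \<rho> by I/2.\<close>

lemma povm_of_test_of_povm: "povm_of_test (test_of_povm E) = E"
  by (simp add: fun_eq_iff povm_of_test_def test_of_povm_def adj2_scaleR adj2_adj2
      flip: scaleR_add_left)

lemma measurement_test_test_of_povm:
  assumes "state_povm E"
  shows "measurement_test (test_of_povm E)"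
proof -
  have sum: "E ConcM + E ConcN + E Inconclusive = mat 1"
    using assms by (simp add: state_povm_def)
  have "adj2 (E ConcM) + adj2 (E ConcN) + adj2 (E Inconclusive) = mat 1"
    by (simp add: sum adj2_mat_1 flip: adj2_add)
  with sum have "test_of_povm E ConcM j + test_of_povm E ConcN j + test_of_povm E Inconclusive j
      = (1/2) *\<^sub>R mat 1" for j
    by (simp add: test_of_povm_def flip: scaleR_add_right)
  moreover have "trace ((1/2) *\<^sub>R mat 1 :: complex^2^2) = 1"
    by (simp add: trace_2 mat_def) (simp add: scaleR_conv_of_real)
  moreover have "psd (test_of_povm E c j)" for c j
    using assms by (simp add: test_of_povm_def state_povm_def psd_scaleR psd_adj2)
  ultimately show ?thesis
    using psd_scaleR[OF psd_mat_1, of "1/2"] by (auto simp: measurement_test_def)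
qed

lemma state_prob_povm_of_test:
  assumes "orthonormal_basis u v"
  shows "state_prob (povm_of_test H) u = measurement_prob H (projective_measurement u v)"
proof
  fix c
  have "braket u (povm_of_test H c *v u) = braket u (H c 1 *v u) + braket u (adj2 (H c 2) *v u)"
    by (simp add: povm_of_test_def braket_def matrix_vector_mult_add_rdistrib sum.distrib distrib_left)
  then show "state_prob (povm_of_test H) u c = measurement_prob H (projective_measurement u v) c"
    by (simp add: state_prob_def measurement_prob_def projective_measurement_def sum_2
        trace_mult_ketbra braket_adj2_orthonormal[OF assms])
qed

theorem theorem3:
  fixes \<phi> \<phi>perp \<psi> \<psi>perp :: "complex^2"
    and M N :: "2 \<Rightarrow> complex^2^2"
    and \<eta>M \<eta>N pf :: real
  assumes "orthonormal_basis \<phi> \<phi>perp" and "orthonormal_basis \<psi> \<psi>perp"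
    and "M = projective_measurement \<phi> \<phi>perp" and "N = projective_measurement \<psi> \<psi>perp"
    and "0 \<le> \<eta>M" and "0 \<le> \<eta>N" and "\<eta>M + \<eta>N = 1"
  shows
    "(\<exists>F G.
        (\<forall>H. measurement_test H \<longrightarrow>
           state_povm (F H) \<and>
           state_prob (F H) \<phi> = measurement_prob H M \<and>
           state_prob (F H) \<psi> = measurement_prob H N \<and>
           (optimal_state_povm \<eta>M \<eta>N \<phi> \<psi> pf (F H) \<longleftrightarrow> optimal_measurement_test \<eta>M \<eta>N M N pf H)) \<and>
        (\<forall>E. state_povm E \<longrightarrow>
           measurement_test (G E) \<and>
           measurement_prob (G E) M = state_prob E \<phi> \<and>
           measurement_prob (G E) N = state_prob E \<psi> \<and>
           (optimal_measurement_test \<eta>M \<eta>N M N pf (G E) \<longleftrightarrow> optimal_state_povm \<eta>M \<eta>N \<phi> \<psi> pf E)))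
     \<and> (\<forall>ps pe.
          (\<exists>H. measurement_test H \<and>
             success_prob \<eta>M \<eta>N (measurement_prob H M) (measurement_prob H N) = ps \<and>
             error_prob \<eta>M \<eta>N (measurement_prob H M) (measurement_prob H N) = pe \<and>
             failure_prob \<eta>M \<eta>N (measurement_prob H M) (measurement_prob H N) = pf)
          \<longleftrightarrow>
          (\<exists>E. state_povm E \<and>
             success_prob \<eta>M \<eta>N (state_prob E \<phi>) (state_prob E \<psi>) = ps \<and>
             error_prob \<eta>M \<eta>N (state_prob E \<phi>) (state_prob E \<psi>) = pe \<and>
             failure_prob \<eta>M \<eta>N (state_prob E \<phi>) (state_prob E \<psi>) = pf))
     \<and> (\<forall>s.
          (\<exists>H. optimal_measurement_test \<eta>M \<eta>N M N pf H \<and>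
             success_prob \<eta>M \<eta>N (measurement_prob H M) (measurement_prob H N) = s)
          \<longleftrightarrow>
          (\<exists>E. optimal_state_povm \<eta>M \<eta>N \<phi> \<psi> pf E \<and>
             success_prob \<eta>M \<eta>N (state_prob E \<phi>) (state_prob E \<psi>) = s))"
proof -
  note test_povm = state_povm_povm_of_test measurement_test_test_of_povm
  have prob: "state_prob (povm_of_test H) \<phi> = measurement_prob H M"
    "state_prob (povm_of_test H) \<psi> = measurement_prob H N" for H
    using assms(1-4) by (simp_all add: state_prob_povm_of_test)
  have prob': "measurement_prob (test_of_povm E) M = state_prob E \<phi>"
    "measurement_prob (test_of_povm E) N = state_prob E \<psi>" for E
    using prob[of "test_of_povm E"] by (simp_all add: povm_of_test_of_povm)
  \<comment> \<open>Both problems attain the same pairs of conclusion distributions, so they agree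
    on every property \<open>P\<close> of such a pair.\<close>
  have transfer: "(\<exists>H. measurement_test H \<and> P (measurement_prob H M) (measurement_prob H N)) \<longleftrightarrow>
      (\<exists>E. state_povm E \<and> P (state_prob E \<phi>) (state_prob E \<psi>))" for P
    by (metis prob prob' test_povm)
  \<comment> \<open>Optimality is the absence of a strictly better competitor with failure rate
    \<open>pf\<close>, and the existence of one is an instance of \<open>transfer\<close>.\<close>
  have opt: "optimal_state_povm \<eta>M \<eta>N \<phi> \<psi> pf E \<longleftrightarrow> optimal_measurement_test \<eta>M \<eta>N M N pf H"
    if "state_povm E" "measurement_test H"
      "state_prob E \<phi> = measurement_prob H M" "state_prob E \<psi> = measurement_prob H N" for E H
    using that
      transfer[of "\<lambda>p q. failure_prob \<eta>M \<eta>N p q = pf \<and> \<not> success_prob \<eta>M \<eta>N p q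
        \<le> success_prob \<eta>M \<eta>N (measurement_prob H M) (measurement_prob H N)"]
    unfolding optimal_state_povm_def optimal_measurement_test_def by auto
  have opt_povm: "optimal_state_povm \<eta>M \<eta>N \<phi> \<psi> pf (povm_of_test H)
      \<longleftrightarrow> optimal_measurement_test \<eta>M \<eta>N M N pf H" if "measurement_test H" for H
    using that by (intro opt prob test_povm)
  have opt_test: "optimal_measurement_test \<eta>M \<eta>N M N pf (test_of_povm E)
      \<longleftrightarrow> optimal_state_povm \<eta>M \<eta>N \<phi> \<psi> pf E" if "state_povm E" for E
    using that by (intro opt[symmetric] prob'[symmetric] test_povm)
  have opt_valid: "optimal_measurement_test \<eta>M \<eta>N M N pf H \<Longrightarrow> measurement_test H"
    "optimal_state_povm \<eta>M \<eta>N \<phi> \<psi> pf E \<Longrightarrow> state_povm E" for H E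
    by (simp_all add: optimal_measurement_test_def optimal_state_povm_def)
  show ?thesis
  proof (intro conjI allI)
    show "\<exists>F G.
        (\<forall>H. measurement_test H \<longrightarrow>
           state_povm (F H) \<and>
           state_prob (F H) \<phi> = measurement_prob H M \<and>
           state_prob (F H) \<psi> = measurement_prob H N \<and>
           (optimal_state_povm \<eta>M \<eta>N \<phi> \<psi> pf (F H) \<longleftrightarrow> optimal_measurement_test \<eta>M \<eta>N M N pf H)) \<and>
        (\<forall>E. state_povm E \<longrightarrow>
           measurement_test (G E) \<and>
           measurement_prob (G E) M = state_prob E \<phi> \<and>
           measurement_prob (G E) N = state_prob E \<psi> \<and>
           (optimal_measurement_test \<eta>M \<eta>N M N pf (G E) \<longleftrightarrow> optimal_state_povm \<eta>M \<eta>N \<phi> \<psi> pf E))"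
      using test_povm prob prob' opt_povm opt_test
      by (intro exI[of _ povm_of_test] exI[of _ test_of_povm]) simp
  \<comment> \<open>The attainable rates are \<open>transfer\<close> with \<open>P\<close> fixing
    all three; for the optimal values, the two maps carry optimal solutions to optimal solutions
    with the same probabilities.\<close>
  qed (rule transfer, metis opt_povm opt_test opt_valid prob prob')
qed

end
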